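(* Let $\mathcal{U}$ be an Ulam set (in an abelian group) with two generators $v_1,v_2$ whose associated lattice is generated by $(-a,b)$, where $a,b>0$, and let $\mathcal{U}'$ be the image of $\alpha=\alpha_{\mathcal{U}}$ in $\mathbb{Z}_{\ge 0}^2$. Then for every $(x,y) \in \mathcal{U}'$ other than $(0,1)$ and $(1,0)$, we have $y \le b(2x-1)$ and $x \le a(2y-1)$.
   Context: Let $G$ be an abelian group (written additively) and $S=\{v_1,\dots,v_k\}\subset G$ a finite set such that $a_1v_1+\cdots+a_kv_k=0$ has no solution in nonnegative integers other than $a_1=\cdots=a_k=0$. Let $D_S$ be the set of nonempty sums of elements of $S$ (repetition allowed); then there is a size function $f:D_S\to\mathbb{R}$ with $f(x+y)>\max\{f(x),f(y)\}$ for all $x,y\in D_S$ and with $f^{-1}((-\infty,r])$ finite for all $r$. The Ulam set $\mathcal{U}(S)$ generated by $S$ is built by first putting in the elements of $S$ and then repeatedly adding a smallest (according to $f$) element of $D_S$ not already in $\mathcal{U}(S)$ that is uniquely represented as the sum of two distinct elements already in $\mathcal{U}(S)$ (with $x+y$ and $y+x$ the same representation); the resulting set does not depend on the choice of $f$ or on tie-breaking. Equivalently, an element not in $S$ is in $\mathcal{U}(S)$ iff it equals $x+y$ for exactly one unordered pair $\{x,y\}$ of distinct elements of $\mathcal{U}(S)$. The associated lattice of $\mathcal{U}(\{v_1,\dots,v_k\})$ is the subgroup of $\mathbb{Z}^k$ of all integer solutions $(x_1,\dots,x_k)$ of $x_1v_1+\cdots+x_kv_k=0$. Here $k=2$ and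 $v_1\neq v_2$, so $a,b$ are not both $1$. The function $\alpha_{\mathcal{U}}:\mathcal{U}\to\mathbb{Z}_{\ge 0}^2$ is defined recursively: $\alpha_{\mathcal{U}}(v_1)=(1,0)$, $\alpha_{\mathcal{U}}(v_2)=(0,1)$; any other $u\in\mathcal{U}$ is written uniquely as $u=u_1+u_2$ with $u_1,u_2$ distinct (previous) elements of $\mathcal{U}$, and $\alpha_{\mathcal{U}}(u)=\alpha_{\mathcal{U}}(u_1)+\alpha_{\mathcal{U}}(u_2)$. *)

theory Defs
  imports Complex_Main "HOL-Library.Product_Plus"
begin

definition zmult :: "int \<Rightarrow> 'a \<Rightarrow> 'a::ab_group_add" where
  "zmult k x = (\<Sum>i<nat k. x) - (\<Sum>i<nat (- k). x)"

definition cyclic_subgroup :: "'a::ab_group_add \<Rightarrow> 'a set" where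
  "cyclic_subgroup g = range (\<lambda>n. zmult n g)"

definition nonempty_sums :: "'a::ab_group_add set \<Rightarrow> 'a set" where
  "nonempty_sums S = {sum_list xs | xs. xs \<noteq> [] \<and> set xs \<subseteq> S}"

definition generating_set :: "'a::ab_group_add set \<Rightarrow> bool" where
  "generating_set S \<longleftrightarrow> finite S \<and>
     (\<forall>c :: 'a \<Rightarrow> nat. (\<Sum>v\<in>S. zmult (int (c v)) v) = 0 \<longrightarrow> (\<forall>v\<in>S. c v = 0))"

text \<open>Only the values of a size function on \<open>nonempty_sums S\<close> matter.\<close>

definition size_function :: "'a::ab_group_add set \<Rightarrow> ('a \<Rightarrow> real) \<Rightarrow> bool" where
  "size_function S f \<longleftrightarrow>
     (\<forall>x\<in>nonempty_sums S. \<forall>y\<in>nonempty_sums S. f (x + y) > max (f x) (f y)) \<and>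
     (\<forall>r. finite {x \<in> nonempty_sums S. f x \<le> r})"

text \<open>Representations are counted as unordered pairs, that is, as two-element sets.\<close>

definition uniquely_represented :: "'a::ab_group_add set \<Rightarrow> 'a \<Rightarrow> bool" where
  "uniquely_represented V z \<longleftrightarrow>
     (\<exists>!P. \<exists>x\<in>V. \<exists>y\<in>V. x \<noteq> y \<and> P = {x, y} \<and> z = x + y)"

definition candidates :: "'a::ab_group_add set \<Rightarrow> 'a set \<Rightarrow> 'a set" where
  "candidates S V = {z \<in> nonempty_sums S. z \<notin> V \<and> uniquely_represented V z}"

text \<open>\<open>V n\<close> is the set obtained after \<open>n\<close> steps; ties are broken arbitrarily, and
  the process becomes stationary if no element can be added.\<close>

definition ulam_construction ::
    "'a::ab_group_add set \<Rightarrow> ('a \<Rightarrow> real) \<Rightarrow> (nat \<Rightarrow> 'a set) \<Rightarrow> bool" where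
  "ulam_construction S f V \<longleftrightarrow> V 0 = S \<and>
     (\<forall>n. if candidates S (V n) = {} then V (Suc n) = V n
          else \<exists>m. is_arg_min f (\<lambda>z. z \<in> candidates S (V n)) m \<and> V (Suc n) = insert m (V n))"

text \<open>The result does not depend on the size function or on the tie-breaking; here any
  outcome of the construction is accepted as the Ulam set generated by \<open>S\<close>.\<close>

definition is_ulam_set :: "'a::ab_group_add set \<Rightarrow> 'a set \<Rightarrow> bool" where
  "is_ulam_set S U \<longleftrightarrow> generating_set S \<and>
     (\<exists>f V. size_function S f \<and> ulam_construction S f V \<and> U = (\<Union>n. V n))"

definition associated_lattice :: "'a::ab_group_add \<Rightarrow> 'a \<Rightarrow> (int \<times> int) set" where
  "associated_lattice v1 v2 = {(x1, x2). zmult x1 v1 + zmult x2 v2 = 0}"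

text \<open>The recursion for \<open>\<alpha>\<close> is given by its graph. When \<open>U\<close> is the Ulam set generated by
  \<open>v1 \<noteq> v2\<close>, the graph is a function on \<open>U\<close>, because every further element of \<open>U\<close> has
  exactly one representation.\<close>

inductive alpha_graph :: "'a::ab_group_add \<Rightarrow> 'a \<Rightarrow> 'a set \<Rightarrow> 'a \<Rightarrow> nat \<times> nat \<Rightarrow> bool"
  for v1 v2 U where
  gen1: "alpha_graph v1 v2 U v1 (1, 0)"
| gen2: "alpha_graph v1 v2 U v2 (0, 1)"
| step: "\<lbrakk>u1 \<in> U; u2 \<in> U; u1 \<noteq> u2; u1 + u2 \<in> U; u1 + u2 \<notin> {v1, v2};
          alpha_graph v1 v2 U u1 p1; alpha_graph v1 v2 U u2 p2\<rbrakk>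
         \<Longrightarrow> alpha_graph v1 v2 U (u1 + u2) (p1 + p2)"

definition alpha :: "'a::ab_group_add \<Rightarrow> 'a \<Rightarrow> 'a set \<Rightarrow> 'a \<Rightarrow> nat \<times> nat" where
  "alpha v1 v2 U u = (THE p. alpha_graph v1 v2 U u p)"

end

theory Submission
  imports Defs
begin

text \<open>
  Write \<open>\<langle>m, n\<rangle>\<close> for \<open>m v1 + n v2\<close>.  The two inequalities are exchanged by
  swapping the generators, so it suffices to prove \<open>y \<le> b (2 x - 1)\<close> for every pair
  \<open>(x, y) \<noteq> (0, 1)\<close> attained by \<open>\<alpha>\<close>.  The proof is an induction along the recursion
  for \<open>\<alpha>\<close>.  If neither summand is \<open>v2\<close>, adding the two bounds even gives
  \<open>y \<le> b (2 x - 2)\<close>, which is \<open>b\<close> better than required.  Hence this slack can only be used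
  up by adding \<open>v2\<close> repeatedly: whenever \<open>y\<close> exceeds \<open>b (2 x - 2)\<close>, all the elements
  \<open>\<langle>x, b (2 x - 2)\<rangle>, \<dots>, \<langle>x, y\<rangle>\<close> lie in the Ulam set.

  The bound could thus first fail at \<open>w = \<langle>x, b (2 x - 1)\<rangle> + v2\<close>, in which case
  \<open>s = \<langle>x, b (2 x - 2)\<rangle>\<close> is in the Ulam set as well.  Because \<open>a v1 = b v2\<close>, also
  \<open>w = s + (a v1 + v2)\<close>.  Now \<open>a v1 + v2\<close> always belongs to the Ulam set (lemma
  \<open>row_one_in_U\<close>), so \<open>w\<close> has two different representations, which is impossible.

  The argument uses the Ulam set only through its description by unique representations.
  That the greedy construction has this property is shown for an arbitrary set of
  generators that admits a size function: along the construction the size of the added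
  elements never decreases, so an element added later cannot be a summand of one added earlier (lemma \<open>ulam_unique\<close>), and since only
  finitely many elements have bounded size, no uniquely represented element is passed over
  forever (lemma \<open>ulam_closed\<close>).
\<close>

section \<open>Integer multiples\<close>

lemma zmult_0 [simp]: "zmult 0 x = 0"
  by (simp add: zmult_def)

lemma zmult_succ: "zmult (k + 1) x = zmult k x + x"
proof (cases "k \<ge> 0")
  case True
  then have "nat (k + 1) = Suc (nat k)" "nat (- (k + 1)) = 0" "nat (- k) = 0"
    by auto
  then show ?thesis
    by (simp add: zmult_def)
next
  case False
  then have "nat (- k) = Suc (nat (- (k + 1)))" "nat (k + 1) = 0" "nat k = 0"
    by auto
  then show ?thesis
    by (simp add: zmult_def)
qed

lemma zmult_1 [simp]: "zmult 1 x = x"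
  using zmult_succ[of 0 x] by simp

lemma zmult_add: "zmult (m + n) x = zmult m x + zmult n x"
proof (induction n rule: int_induct[where k = 0])
  case base
  show ?case by simp
next
  case (step1 i)
  have "zmult (m + (i + 1)) x = zmult (m + i) x + x"
    using zmult_succ[of "m + i" x] by (simp add: add.assoc)
  then show ?case
    using step1 zmult_succ[of i x] by (simp add: add.assoc)
next
  case (step2 i)
  have "zmult (m + i) x = zmult (m + (i - 1)) x + x"
    using zmult_succ[of "m + (i - 1)" x] by (simp add: algebra_simps)
  moreover have "zmult i x = zmult (i - 1) x + x"
    using zmult_succ[of "i - 1" x] by simp
  ultimately show ?case
    using step2 by (simp add: algebra_simps)
qed

lemma zmult_diff: "zmult (m - n) x = zmult m x - zmult n x"
  using zmult_add[of "m - n" n x] by (simp add: algebra_simps)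

lemma zmult_int_pair: "zmult k (p, q) = (k * p, k * q)" for p q :: int
proof (induction k rule: int_induct[where k = 0])
  case base
  show ?case by (simp add: zero_prod_def)
next
  case (step1 i)
  then show ?case
    using zmult_add[of i 1 "(p, q)"] by (simp add: algebra_simps)
next
  case (step2 i)
  then show ?case
    using zmult_diff[of i 1 "(p, q)"] by (simp add: algebra_simps)
qed

section \<open>The greedy construction and unique representation\<close>

lemma nonempty_sums_add:
  assumes "x \<in> nonempty_sums S" "y \<in> nonempty_sums S"
  shows "x + y \<in> nonempty_sums S"
proof -
  obtain xs ys where "x = sum_list xs" "xs \<noteq> []" "set xs \<subseteq> S"
    "y = sum_list ys" "set ys \<subseteq> S"
    using assms unfolding nonempty_sums_def by auto
  then show ?thesis
    unfolding nonempty_sums_def by (auto intro!: exI[of _ "xs @ ys"])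
qed

lemma generator_in_nonempty_sums: "x \<in> S \<Longrightarrow> x \<in> nonempty_sums S"
  unfolding nonempty_sums_def by (auto intro!: exI[of _ "[x]"])

lemma uniquely_representedE:
  assumes "uniquely_represented V z"
  obtains x y where "x \<in> V" "y \<in> V" "x \<noteq> y" "z = x + y"
    "\<And>p q. p \<in> V \<Longrightarrow> q \<in> V \<Longrightarrow> p \<noteq> q \<Longrightarrow> z = p + q \<Longrightarrow> {p, q} = {x, y}"
proof -
  obtain P where P: "\<exists>x\<in>V. \<exists>y\<in>V. x \<noteq> y \<and> P = {x, y} \<and> z = x + y"
    and uniq: "\<And>Q. \<exists>x\<in>V. \<exists>y\<in>V. x \<noteq> y \<and> Q = {x, y} \<and> z = x + y \<Longrightarrow> Q = P"
    using assms unfolding uniquely_represented_def by (elim ex1E) blast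
  obtain x y where xy: "x \<in> V" "y \<in> V" "x \<noteq> y" "P = {x, y}" "z = x + y"
    using P by blast
  show ?thesis
  proof (rule that[OF xy(1-3) xy(5)])
    fix p q assume "p \<in> V" "q \<in> V" "p \<noteq> q" "z = p + q"
    then show "{p, q} = {x, y}"
      using uniq[of "{p, q}"] xy(4) by blast
  qed
qed

lemma uniquely_representedI:
  assumes "x \<in> V" "y \<in> V" "x \<noteq> y" "z = x + y"
    and "\<And>p q. p \<in> V \<Longrightarrow> q \<in> V \<Longrightarrow> p \<noteq> q \<Longrightarrow> z = p + q \<Longrightarrow> {p, q} = {x, y}"
  shows "uniquely_represented V z"
  unfolding uniquely_represented_def
proof (rule ex1I[of _ "{x, y}"])
  show "\<exists>p\<in>V. \<exists>q\<in>V. p \<noteq> q \<and> {x, y} = {p, q} \<and> z = p + q"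
    using assms(1-4) by blast
  show "P = {x, y}" if "\<exists>p\<in>V. \<exists>q\<in>V. p \<noteq> q \<and> P = {p, q} \<and> z = p + q" for P
    using that assms(5) by blast
qed

locale greedy_ulam =
  fixes S :: "'a::ab_group_add set" and f :: "'a \<Rightarrow> real" and V :: "nat \<Rightarrow> 'a set"
  assumes size: "size_function S f" and construction: "ulam_construction S f V"
begin

lemma size_add:
  assumes "x \<in> nonempty_sums S" "y \<in> nonempty_sums S"
  shows "f x < f (x + y)" "f y < f (x + y)"
  using size assms unfolding size_function_def by force+

lemma stage_0: "V 0 = S"
  using construction unfolding ulam_construction_def by simp

lemma stage_Suc:
  obtains (stationary) "candidates S (V n) = {}" "V (Suc n) = V n"
  | (extend) m where "m \<in> candidates S (V n)" "V (Suc n) = insert m (V n)"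
      "\<And>w. w \<in> candidates S (V n) \<Longrightarrow> f m \<le> f w"
proof (cases "candidates S (V n) = {}")
  case True
  then have "V (Suc n) = V n"
    using construction unfolding ulam_construction_def by presburger
  with True show ?thesis by (rule stationary)
next
  case False
  then obtain m where "is_arg_min f (\<lambda>z. z \<in> candidates S (V n)) m" "V (Suc n) = insert m (V n)"
    using construction unfolding ulam_construction_def by metis
  then show ?thesis
    using extend unfolding is_arg_min_def by (meson not_less)
qed

lemma stage_mono: "m \<le> n \<Longrightarrow> V m \<subseteq> V n"
proof (rule lift_Suc_mono_le)
  show "V i \<subseteq> V (Suc i)" for i
    by (cases i rule: stage_Suc) auto
qed

lemma stage_subset_sums: "V n \<subseteq> nonempty_sums S"
proof (induction n)
  case 0
  then show ?case using stage_0 generator_in_nonempty_sums by auto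
next
  case (Suc n)
  show ?case
    using Suc by (cases n rule: stage_Suc) (auto simp: candidates_def)
qed

text \<open>A candidate that was not one a step earlier has the element just added as a summand,
  so it is larger than that element.\<close>

lemma candidates_lower_bound_Suc:
  assumes bound: "\<And>w. w \<in> candidates S (V n) \<Longrightarrow> r \<le> f w"
    and w: "w \<in> candidates S (V (Suc n))"
  shows "r \<le> f w"
proof (cases n rule: stage_Suc)
  case stationary
  then show ?thesis using w by simp
next
  case (extend m)
  have w': "w \<in> nonempty_sums S" "w \<notin> V (Suc n)" "uniquely_represented (V (Suc n)) w"
    using w by (auto simp: candidates_def)
  from w'(3) obtain x y where xy: "x \<in> V (Suc n)" "y \<in> V (Suc n)" "x \<noteq> y" "w = x + y"
    and uniq: "\<And>p q. p \<in> V (Suc n) \<Longrightarrow> q \<in> V (Suc n) \<Longrightarrow> p \<noteq> q \<Longrightarrow> w = p + q \<Longrightarrow> {p, q} = {x, y}"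
    by (rule uniquely_representedE) blast
  show ?thesis
  proof (cases "x \<in> V n \<and> y \<in> V n")
    case True
    have "uniquely_represented (V n) w"
    proof (rule uniquely_representedI[of x _ y])
      fix p q assume pq: "p \<in> V n" "q \<in> V n" "p \<noteq> q" "w = p + q"
      then have "p \<in> V (Suc n)" "q \<in> V (Suc n)"
        using extend(2) by auto
      then show "{p, q} = {x, y}"
        by (rule uniq) (use pq in auto)
    qed (use True xy in auto)
    then have "w \<in> candidates S (V n)"
      using w' extend by (auto simp: candidates_def)
    then show ?thesis by (rule bound)
  next
    case False
    then have "x = m \<or> y = m"
      using xy extend by auto
    moreover have "x \<in> nonempty_sums S" "y \<in> nonempty_sums S"
      using xy stage_subset_sums by auto
    ultimately have "f m < f w"
      using size_add[of x y] xy(4) by auto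
    then show ?thesis
      using bound[OF extend(1)] by simp
  qed
qed

lemma candidates_lower_bound:
  assumes "\<And>w. w \<in> candidates S (V n) \<Longrightarrow> r \<le> f w" and "n \<le> m"
    and "w \<in> candidates S (V m)"
  shows "r \<le> f w"
  using assms(2,3)
proof (induction m arbitrary: w rule: dec_induct)
  case base
  then show ?case using assms(1) by blast
next
  case (step m)
  then show ?case using candidates_lower_bound_Suc by blast
qed

lemma added_at_stage:
  assumes "u \<in> (\<Union>n. V n)" "u \<notin> V k"
  obtains m where "k \<le> m" "u \<in> candidates S (V m)" "V (Suc m) = insert u (V m)"
    "\<And>w. w \<in> candidates S (V m) \<Longrightarrow> f u \<le> f w"
proof -
  obtain n where n: "u \<in> V n"
    using assms(1) by blast
  have "\<exists>m\<ge>k. u \<notin> V m \<and> u \<in> V (Suc m)"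
  proof (rule ccontr)
    assume neg: "\<not> ?thesis"
    have "k \<le> m \<Longrightarrow> u \<notin> V m" for m
      by (induction m rule: dec_induct) (use assms(2) neg in auto)
    then show False
      using n stage_mono[of n k] assms(2) by (meson linear subsetD)
  qed
  then obtain m where m: "k \<le> m" "u \<notin> V m" "u \<in> V (Suc m)"
    by blast
  show ?thesis
  proof (cases m rule: stage_Suc)
    case stationary
    then show ?thesis using m by simp
  next
    case (extend z)
    then have "z = u" using m by auto
    then show ?thesis using that m extend by auto
  qed
qed

text \<open>The summands of an element have smaller size, hence are already present when it is
  added: uniqueness at that stage is uniqueness in the limit.\<close>

lemma ulam_unique:
  assumes "u \<in> (\<Union>n. V n)" "u \<notin> S"
  shows "uniquely_represented (\<Union>n. V n) u"
proof -
  obtain m where m: "u \<in> candidates S (V m)"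
    and min: "\<And>w. w \<in> candidates S (V m) \<Longrightarrow> f u \<le> f w"
    using added_at_stage[OF assms(1), of 0] assms(2) unfolding stage_0 by metis
  have later: "f u \<le> f w" if new: "w \<in> (\<Union>n. V n)" "w \<notin> V m" for w
  proof -
    obtain k where "m \<le> k" "w \<in> candidates S (V k)"
      using added_at_stage[OF new] by metis
    then show ?thesis
      using candidates_lower_bound[of m "f u" k w] min by blast
  qed
  have "uniquely_represented (V m) u"
    using m by (simp add: candidates_def)
  then obtain x y where xy: "x \<in> V m" "y \<in> V m" "x \<noteq> y" "u = x + y"
    and uniq: "\<And>p q. p \<in> V m \<Longrightarrow> q \<in> V m \<Longrightarrow> p \<noteq> q \<Longrightarrow> u = p + q \<Longrightarrow> {p, q} = {x, y}"
    by (rule uniquely_representedE) blast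
  show ?thesis
  proof (rule uniquely_representedI[of x _ y])
    fix p q assume pq: "p \<in> (\<Union>n. V n)" "q \<in> (\<Union>n. V n)" "p \<noteq> q" "u = p + q"
    have "f p < f u" "f q < f u"
      using size_add[of p q] pq stage_subset_sums by blast+
    then have "p \<in> V m" "q \<in> V m"
      using later[OF pq(1)] later[OF pq(2)] by force+
    then show "{p, q} = {x, y}"
      using uniq pq by blast
  qed (use xy in auto)
qed

text \<open>If a uniquely represented element were never added, it would remain a candidate from some stage on,
  and each of the infinitely many elements added from then on would be at most as large.\<close>

lemma ulam_closed:
  assumes "z \<in> nonempty_sums S" "uniquely_represented (\<Union>n. V n) z"
  shows "z \<in> (\<Union>n. V n)"
proof (rule ccontr)
  assume nz: "z \<notin> (\<Union>n. V n)"
  from assms(2) obtain x y where xy: "x \<in> (\<Union>n. V n)" "y \<in> (\<Union>n. V n)" "x \<noteq> y" "z = x + y"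
    and uniq: "\<And>p q. p \<in> (\<Union>n. V n) \<Longrightarrow> q \<in> (\<Union>n. V n) \<Longrightarrow> p \<noteq> q \<Longrightarrow> z = p + q \<Longrightarrow> {p, q} = {x, y}"
    by (rule uniquely_representedE) blast
  obtain i j where "x \<in> V i" "y \<in> V j"
    using xy by blast
  then have n: "x \<in> V (i + j + d)" "y \<in> V (i + j + d)" for d
    using stage_mono[of i "i + j + d"] stage_mono[of j "i + j + d"] by auto
  have cand: "z \<in> candidates S (V (i + j + d))" for d
  proof -
    have "uniquely_represented (V (i + j + d)) z"
      using n xy uniq by (intro uniquely_representedI[of x _ y]) blast+
    then show ?thesis
      using assms(1) nz by (auto simp: candidates_def)
  qed
  have "\<exists>w. w \<in> V (Suc (i + j + d)) \<and> w \<notin> V (i + j + d) \<and> f w \<le> f z" for d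
    using cand[of d] by (cases "i + j + d" rule: stage_Suc) (auto simp: candidates_def)
  then obtain w where w: "\<And>d. w d \<in> V (Suc (i + j + d))" "\<And>d. w d \<notin> V (i + j + d)"
    "\<And>d. f (w d) \<le> f z"
    by metis
  have "w d \<noteq> w e" if "d < e" for d e
    using w(1)[of d] w(2)[of e] stage_mono[of "Suc (i + j + d)" "i + j + e"] that by auto
  then have "inj w"
    by (metis injI linorder_neqE_nat)
  moreover have "range w \<subseteq> {x \<in> nonempty_sums S. f x \<le> f z}"
    using w stage_subset_sums by blast
  moreover have "finite {x \<in> nonempty_sums S. f x \<le> f z}"
    using size unfolding size_function_def by blast
  ultimately show False
    using finite_subset finite_imageD infinite_UNIV_nat by blast
qed

end

section \<open>Ulam sets with two generators\<close>

text \<open>The lattice is given by the relations themselves, which makes the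
  assumptions symmetric under swapping \<open>(v1, a)\<close> and \<open>(v2, b)\<close>.\<close>

locale two_generator_ulam =
  fixes v1 v2 :: "'a::ab_group_add" and U :: "'a set" and a b :: int
  assumes distinct: "v1 \<noteq> v2"
    and ulam: "is_ulam_set {v1, v2} U"
    and pos: "a > 0" "b > 0"
    and relations:
      "\<And>m n. zmult m v1 + zmult n v2 = 0 \<longleftrightarrow> (\<exists>k. m = - (k * a) \<and> n = k * b)"
begin

definition comb :: "int \<Rightarrow> int \<Rightarrow> 'a" where
  "comb m n = zmult m v1 + zmult n v2"

lemma comb_gen [simp]: "comb 1 0 = v1" "comb 0 1 = v2"
  by (simp_all add: comb_def)

lemma comb_add: "comb m n + comb m' n' = comb (m + m') (n + n')"
  by (simp add: comb_def zmult_add algebra_simps)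

lemma comb_eq_iff: "comb m n = comb m' n' \<longleftrightarrow> (\<exists>k. m - m' = - (k * a) \<and> n - n' = k * b)"
proof -
  have "comb m n = comb m' n' \<longleftrightarrow> zmult (m - m') v1 + zmult (n - n') v2 = 0"
    by (simp add: comb_def zmult_diff algebra_simps)
  then show ?thesis by (simp add: relations)
qed

lemma comb_eq_nonneg:
  assumes "comb m n = comb m' n'" "m \<ge> m'" "n \<ge> n'"
  shows "m = m' \<and> n = n'"
proof -
  obtain k where k: "m - m' = - (k * a)" "n - n' = k * b"
    using assms(1) comb_eq_iff by blast
  then have "k * a \<le> 0" "0 \<le> k * b"
    using assms by linarith+
  then have "k = 0"
    using pos by (simp add: mult_le_0_iff zero_le_mult_iff)
  then show ?thesis using k by simp
qed

lemma generators_in_U: "v1 \<in> U" "v2 \<in> U"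
  and U_subset_sums: "U \<subseteq> nonempty_sums {v1, v2}"
  and U_unique: "\<And>u. u \<in> U \<Longrightarrow> u \<notin> {v1, v2} \<Longrightarrow> uniquely_represented U u"
  and U_closed: "\<And>z. z \<in> nonempty_sums {v1, v2} \<Longrightarrow> uniquely_represented U z \<Longrightarrow> z \<in> U"
  and alpha_graph_exists: "\<And>u. u \<in> U \<Longrightarrow> \<exists>p. alpha_graph v1 v2 U u p"
proof -
  obtain f V where fV: "size_function {v1, v2} f" "ulam_construction {v1, v2} f V"
    and U: "U = (\<Union>n. V n)"
    using ulam unfolding is_ulam_set_def by blast
  interpret greedy_ulam "{v1, v2}" f V
    by unfold_locales (fact fV)+
  show gens: "v1 \<in> U" "v2 \<in> U"
    using stage_0 U by blast+
  show "U \<subseteq> nonempty_sums {v1, v2}"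
    using stage_subset_sums U by blast
  show "uniquely_represented U u" if "u \<in> U" "u \<notin> {v1, v2}" for u
    using ulam_unique that U by simp
  show "z \<in> U" if "z \<in> nonempty_sums {v1, v2}" "uniquely_represented U z" for z
    using ulam_closed that U by simp
  have "u \<in> V n \<Longrightarrow> \<exists>p. alpha_graph v1 v2 U u p" for u n
  proof (induction n arbitrary: u)
    case 0
    then show ?case
      using stage_0 alpha_graph.gen1[of v1 v2 U] alpha_graph.gen2[of v1 v2 U] by auto
  next
    case (Suc n)
    show ?case
    proof (cases "u \<in> V n")
      case True
      then show ?thesis using Suc.IH by blast
    next
      case False
      then have cand: "u \<in> candidates {v1, v2} (V n)"
        using Suc.prems by (cases n rule: stage_Suc) auto
      then obtain x y where xy: "x \<in> V n" "y \<in> V n" "x \<noteq> y" "u = x + y"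
        unfolding candidates_def by (blast elim: uniquely_representedE)
      have mem: "x \<in> U" "y \<in> U" "x + y \<in> U"
        using xy Suc.prems U by auto
      have "x + y \<notin> {v1, v2}"
        using False xy stage_mono[of 0 n] stage_0 by auto
      then show ?thesis
        using mem xy Suc.IH[OF xy(1)] Suc.IH[OF xy(2)] alpha_graph.step by metis
    qed
  qed
  then show "\<exists>p. alpha_graph v1 v2 U u p" if "u \<in> U" for u
    using that U by blast
qed

lemma unique_pair:
  assumes "p + q \<in> U" "p + q \<notin> {v1, v2}" "p + q = p' + q'"
    and "p \<in> U" "q \<in> U" "p \<noteq> q" "p' \<in> U" "q' \<in> U" "p' \<noteq> q'"
  shows "{p, q} = {p', q'}"
proof -
  obtain x y where
    uniq: "\<And>r s. r \<in> U \<Longrightarrow> s \<in> U \<Longrightarrow> r \<noteq> s \<Longrightarrow> p + q = r + s \<Longrightarrow> {r, s} = {x, y}"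
    using U_unique[OF assms(1,2)] by (rule uniquely_representedE) blast
  show ?thesis
    using uniq[of p q] uniq[of p' q'] assms by simp
qed

lemma alpha_graph_functional:
  assumes "alpha_graph v1 v2 U u p" "alpha_graph v1 v2 U u q"
  shows "p = q"
  using assms
proof (induction arbitrary: q rule: alpha_graph.induct)
  case gen1
  then show ?case
    by (cases rule: alpha_graph.cases) (use distinct in auto)
next
  case gen2
  then show ?case
    by (cases rule: alpha_graph.cases) (use distinct in auto)
next
  case (step u1 u2 p1 p2)
  from step.prems show ?case
  proof (cases rule: alpha_graph.cases)
    case gen1
    then show ?thesis using step.hyps by simp
  next
    case gen2
    then show ?thesis using step.hyps by simp
  next
    case (step w1 w2 q1 q2)
    have "{u1, u2} = {w1, w2}"
      using step step.hyps by (intro unique_pair) auto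
    then consider "u1 = w1" "u2 = w2" | "u1 = w2" "u2 = w1"
      by (auto simp: doubleton_eq_iff)
    then show ?thesis
      using step step.IH by cases (auto simp: add.commute)
  qed
qed

lemma alpha_graph_alpha: "u \<in> U \<Longrightarrow> alpha_graph v1 v2 U u (alpha v1 v2 U u)"
  unfolding alpha_def
  by (rule theI') (use alpha_graph_exists alpha_graph_functional in blast)

lemma alpha_graph_in_U: "alpha_graph v1 v2 U u p \<Longrightarrow> u \<in> U"
  by (induction rule: alpha_graph.induct) (use generators_in_U in auto)

lemma alpha_graph_comb: "alpha_graph v1 v2 U u (x, y) \<Longrightarrow> u = comb (int x) (int y)"
proof (induction u "(x, y)" arbitrary: x y rule: alpha_graph.induct)
  case (step u1 u2 p1 p2)
  then show ?case
    by (cases p1; cases p2) (auto simp: comb_add)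
qed simp_all

text \<open>The summands of an element of an axis lie on the same axis, so by induction both are
  the generator there; but they must be distinct.\<close>

lemma alpha_graph_axes:
  "alpha_graph v1 v2 U u (x, y) \<Longrightarrow>
    (x = 0 \<longrightarrow> y = 1 \<and> u = v2) \<and> (y = 0 \<longrightarrow> x = 1 \<and> u = v1)"
proof (induction u "(x, y)" arbitrary: x y rule: alpha_graph.induct)
  case (step u1 u2 p1 p2)
  obtain x1 y1 x2 y2 where p: "p1 = (x1, y1)" "p2 = (x2, y2)"
    by (cases p1; cases p2)
  then have "x = x1 + x2" "y = y1 + y2"
    using step.hyps by auto
  then show ?case
    using step.hyps(3) step.hyps(7)[OF p(1)] step.hyps(9)[OF p(2)] by auto
qed simp_all

text \<open>For \<open>k \<le> a\<close> the point \<open>(k, 1)\<close> is congruent to other points of the quadrant only if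
  these lie on an axis, where the sum of the \<open>\<alpha>\<close>-values of two distinct elements
  never lies.  So for \<open>k \<ge> 1\<close> the only representation of \<open>k v1 + v2\<close> splits off
  \<open>v1\<close>.\<close>

lemma row_one_in_U:
  assumes "int k \<le> a"
  shows "comb (int k) 1 \<in> U"
  using assms
proof (induction k)
  case 0
  then show ?case using generators_in_U by simp
next
  case (Suc k)
  let ?w = "comb (int k) 1"
  let ?z = "comb (int (Suc k)) 1"
  have w: "?w \<in> U" using Suc by simp
  have z: "?z = v1 + ?w"
    using comb_add[of 1 0 "int k" 1] by (simp add: algebra_simps)
  have ne: "v1 \<noteq> ?w"
  proof
    assume eq: "v1 = ?w"
    show False
    proof (cases k)
      case 0
      then show ?thesis using eq distinct by simp
    next
      case (Suc j)
      then show ?thesis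
        using comb_eq_nonneg[of "int k" 1 1 0] eq by simp
    qed
  qed
  have "uniquely_represented U ?z"
  proof (rule uniquely_representedI[OF generators_in_U(1) w ne z])
    fix p q assume pq: "p \<in> U" "q \<in> U" "p \<noteq> q" "?z = p + q"
    obtain x1 y1 x2 y2 where g: "alpha_graph v1 v2 U p (x1, y1)" "alpha_graph v1 v2 U q (x2, y2)"
      using alpha_graph_exists pq by (metis surj_pair)
    note ax = alpha_graph_axes[OF g(1)] alpha_graph_axes[OF g(2)]
    have "comb (int x1 + int x2) (int y1 + int y2) = comb (int (Suc k)) 1"
      using pq(4) alpha_graph_comb[OF g(1)] alpha_graph_comb[OF g(2)] by (simp add: comb_add)
    then obtain j where j: "int x1 + int x2 - int (Suc k) = - (j * a)"
      "int y1 + int y2 - 1 = j * b"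
      using comb_eq_iff by blast
    have off_axes: "x1 + x2 > 0" "y1 + y2 > 0"
      using ax pq(3) by auto
    have "j = 0"
    proof (rule ccontr)
      assume "j \<noteq> 0"
      then consider "j \<ge> 1" | "j \<le> -1" by linarith
      then show False
      proof cases
        case 1
        then have "j * a \<ge> 1 * a"
          using pos by (intro mult_right_mono) auto
        then show False using j(1) off_axes Suc.prems by linarith
      next
        case 2
        then have "j * b \<le> (-1) * b"
          using pos by (intro mult_right_mono) auto
        then show False using j(2) off_axes pos by linarith
      qed
    qed
    then have "y1 + y2 = 1" using j by auto
    then have "p = v1 \<or> q = v1"
      using ax by (cases "y1 = 0") auto
    then show "{p, q} = {v1, ?w}"
    proof
      assume "p = v1"
      then have "q = ?w" using pq(4) z by simp
      then show ?thesis using \<open>p = v1\<close> by simp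
    next
      assume "q = v1"
      then have "p = ?w" using pq(4) z by (simp add: add.commute)
      then show ?thesis using \<open>q = v1\<close> by auto
    qed
  qed
  moreover have "?z \<in> nonempty_sums {v1, v2}"
    using z w generators_in_U U_subset_sums nonempty_sums_add by (metis subsetD)
  ultimately show ?case by (rule U_closed[rotated])
qed

text \<open>The point \<open>(x, b (2 x - 1))\<close> is where the bound is attained.  The relation
  \<open>a v1 = b v2\<close> yields a second representation of its sum with \<open>v2\<close>.\<close>

lemma extremal_point_no_successor:
  assumes x: "x \<ge> 1" and y: "y = b * (2 * x - 1)"
    and top: "comb x y \<in> U" and bottom: "comb x (y - b) \<in> U"
    and ne: "comb x y \<noteq> v2" and sum: "comb x y + v2 \<in> U" "comb x y + v2 \<notin> {v1, v2}"
  shows False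
proof -
  let ?s = "comb x (y - b)" and ?t = "comb a 1"
  have t: "?t \<in> U"
    using row_one_in_U[of "nat a"] pos by simp
  have yb: "y - b = 2 * b * (x - 1)"
    using y by (simp add: algebra_simps)
  have big: "y - b \<ge> 2" if "x \<ge> 2"
  proof -
    have "b * (x - 1) \<ge> 1 * 1"
      using that pos by (intro mult_mono) auto
    then show ?thesis using yb by simp
  qed
  have "comb x (y + 1) = comb (x + a) (y - b + 1)"
    unfolding comb_eq_iff by (rule exI[of _ 1]) simp
  then have eq: "comb x y + v2 = ?s + ?t"
    using comb_add[of x y 0 1] comb_add[of x "y - b" a 1] by simp
  \<comment> \<open>Equality would force \<open>x = 1\<close> and \<open>k = - 1\<close> in the relation between the two points,
    hence \<open>1 = 2 a\<close>.\<close>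
  have "?s \<noteq> ?t"
  proof
    assume "?s = ?t"
    then obtain k where k: "x - a = - (k * a)" "y - b - 1 = k * b"
      using comb_eq_iff by blast
    have "(1 - k) * a > 0"
      using k(1) x by (simp add: algebra_simps)
    then have "k \<le> 0"
      using pos by (simp add: zero_less_mult_iff)
    then have "k * b \<le> 0"
      using pos by (simp add: mult_le_0_iff)
    then have "x = 1"
      using big k(2) x by force
    then have "k * b = -1"
      using k(2) yb by simp
    then have "b * (- k) = 1"
      by (simp add: algebra_simps)
    then have "k = -1"
      using pos_zmult_eq_1_iff[of b "- k"] pos by simp
    then show False
      using k(1) \<open>x = 1\<close> by presburger
  qed
  then have "{comb x y, v2} = {?s, ?t}"
    using sum eq top bottom t ne generators_in_U by (intro unique_pair) auto
  then have "v2 = ?s \<or> v2 = ?t"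
    by (auto simp: doubleton_eq_iff)
  then show False
  proof
    assume eq: "v2 = ?s"
    show False
    proof (cases "x = 1")
      case True
      then show ?thesis using eq yb distinct by simp
    next
      case False
      then show ?thesis
        using comb_eq_nonneg[of x "y - b" 0 1] eq big x by force
    qed
  next
    assume "v2 = ?t"
    then show False
      using comb_eq_nonneg[of a 1 0 1] pos by simp
  qed
qed

text \<open>The last clause records the columns of \<open>v2\<close>-translates below points
  with \<open>y > b (2 x - 2)\<close>: it is trivial when both summands obey the bound, and adding \<open>v2\<close>
  prolongs the column.  The generator \<open>v1\<close> obeys the general bound, so only \<open>v2\<close> is
  exceptional.\<close>

lemma alpha_graph_bound_and_column:
  assumes "alpha_graph v1 v2 U u (x, y)"
  shows "(x, y) = (0, 1) \<or>
    (1 \<le> x \<and> int y \<le> b * (2 * int x - 1) \<and>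
     (\<forall>i\<ge>0. i \<le> int y - b * (2 * int x - 2) \<longrightarrow> comb (int x) (int y - i) \<in> U))"
    (is "_ \<or> ?inv x y")
  using assms
proof (induction u "(x, y)" arbitrary: x y rule: alpha_graph.induct)
  case gen1
  then show ?case using generators_in_U pos by auto
next
  case gen2
  then show ?case by simp
next
  case (step u1 u2 p1 p2)
  obtain x1 y1 x2 y2 where p: "p1 = (x1, y1)" "p2 = (x2, y2)"
    by (cases p1; cases p2)
  have xy: "x = x1 + x2" "y = y1 + y2"
    using p step.hyps by auto
  have g: "alpha_graph v1 v2 U u1 (x1, y1)" "alpha_graph v1 v2 U u2 (x2, y2)"
    using p step.hyps by auto
  have u: "u1 + u2 = comb (int x) (int y)"
    using alpha_graph_comb[OF g(1)] alpha_graph_comb[OF g(2)] xy by (simp add: comb_add)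
  have add_v2: "?inv (x') (Suc y')"
    if inv: "?inv x' y'" and g': "alpha_graph v1 v2 U u' (x', y')" and ne: "u' \<noteq> v2"
      and sum: "u' + v2 \<in> U" "u' + v2 \<notin> {v1, v2}"
    for u' x' y'
  proof -
    have u': "u' = comb (int x') (int y')"
      by (rule alpha_graph_comb[OF g'])
    have column: "comb (int x') (int y' - i) \<in> U"
      if "0 \<le> i" "i \<le> int y' - b * (2 * int x' - 2)" for i
      using inv that by blast
    have "int y' \<noteq> b * (2 * int x' - 1)"
    proof
      assume y': "int y' = b * (2 * int x' - 1)"
      have "comb (int x') (int y' - b) \<in> U"
      proof (rule column)
        show "b \<le> int y' - b * (2 * int x' - 2)"
          unfolding y' by (simp add: algebra_simps)
      qed (use pos in simp)
      then show False
        using extremal_point_no_successor[of "int x'" "int y'"] y' inv u' ne sum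
          alpha_graph_in_U[OF g'] by auto
    qed
    moreover have "comb (int x') (int (Suc y') - i) \<in> U"
      if "0 \<le> i" "i \<le> int (Suc y') - b * (2 * int x' - 2)" for i
    proof (cases "i = 0")
      case True
      then show ?thesis
        using sum u' comb_add[of "int x'" "int y'" 0 1] by (simp add: add.commute)
    next
      case False
      then show ?thesis
        using column[of "i - 1"] that by (simp add: algebra_simps)
    qed
    ultimately show ?thesis
      using inv by auto
  qed
  consider "(x1, y1) = (0, 1)" "(x2, y2) = (0, 1)" | "(x1, y1) = (0, 1)" "?inv x2 y2"
    | "?inv x1 y1" "(x2, y2) = (0, 1)" | "?inv x1 y1" "?inv x2 y2"
    using step.hyps(7)[OF p(1)] step.hyps(9)[OF p(2)] by blast
  then show ?case
  proof cases
    case 1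
    then show ?thesis
      using alpha_graph_axes[OF g(1)] alpha_graph_axes[OF g(2)] step.hyps by simp
  next
    case 2
    then have "u1 = v2"
      using alpha_graph_axes[OF g(1)] by simp
    then show ?thesis
      using add_v2[OF 2(2) g(2)] step.hyps 2(1) xy by (simp add: add.commute)
  next
    case 3
    then have "u2 = v2"
      using alpha_graph_axes[OF g(2)] by simp
    then show ?thesis
      using add_v2[OF 3(1) g(1)] step.hyps 3(2) xy by simp
  next
    case 4
    have "int y1 + int y2 \<le> b * (2 * int x1 - 1) + b * (2 * int x2 - 1)"
      using 4 by (intro add_mono) auto
    then have slack: "int y \<le> b * (2 * int x - 2)"
      using xy by (simp add: algebra_simps)
    then have "int y \<le> b * (2 * int x - 1)"
      using pos by (simp add: algebra_simps)
    moreover have "comb (int x) (int y - i) \<in> U"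
      if "0 \<le> i" "i \<le> int y - b * (2 * int x - 2)" for i
    proof -
      have "i = 0" using slack that by linarith
      then show ?thesis using u step.hyps(4) by simp
    qed
    ultimately show ?thesis
      using 4 xy by auto
  qed
qed

end

section \<open>Swapping the generators\<close>

lemma two_generator_ulam_swap:
  assumes "two_generator_ulam v1 v2 U a b"
  shows "two_generator_ulam v2 v1 U b a"
proof -
  interpret two_generator_ulam v1 v2 U a b by fact
  show ?thesis
  proof
    show "v2 \<noteq> v1" "b > 0" "a > 0"
      using distinct pos by auto
    show "is_ulam_set {v2, v1} U"
      using ulam by (simp add: insert_commute)
    fix m n
    have "zmult m v2 + zmult n v1 = 0 \<longleftrightarrow> (\<exists>k. n = - (k * a) \<and> m = k * b)"
      using relations[of n m] by (simp add: add.commute)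
    also have "\<dots> \<longleftrightarrow> (\<exists>k. m = - (k * b) \<and> n = k * a)"
      by (metis minus_minus mult_minus_left)
    finally show "zmult m v2 + zmult n v1 = 0 \<longleftrightarrow> (\<exists>k. m = - (k * b) \<and> n = k * a)" .
  qed
qed

lemma alpha_graph_swap:
  "alpha_graph v1 v2 U u p \<Longrightarrow> alpha_graph v2 v1 U u (prod.swap p)"
proof (induction rule: alpha_graph.induct)
  case gen1
  then show ?case using alpha_graph.gen2[of v2 v1 U] by simp
next
  case gen2
  then show ?case using alpha_graph.gen1[of v2 v1 U] by simp
next
  case (step u1 u2 p1 p2)
  then have "alpha_graph v2 v1 U (u1 + u2) (prod.swap p1 + prod.swap p2)"
    by (intro alpha_graph.step) auto
  then show ?case
    by (simp add: plus_prod_def prod.swap_def)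
qed

theorem theorem4p10:
  fixes v1 v2 :: "'a::ab_group_add" and U :: "'a set" and a b :: int and x y :: nat
  assumes "v1 \<noteq> v2"
    and "is_ulam_set {v1, v2} U"
    and "a > 0" and "b > 0"
    and "associated_lattice v1 v2 = cyclic_subgroup (- a, b)"
    and "(x, y) \<in> alpha v1 v2 U ` U"
    and "(x, y) \<noteq> (0, 1)" and "(x, y) \<noteq> (1, 0)"
  shows "int y \<le> b * (2 * int x - 1) \<and> int x \<le> a * (2 * int y - 1)"
proof -
  have rel: "zmult m v1 + zmult n v2 = 0 \<longleftrightarrow> (\<exists>k. m = - (k * a) \<and> n = k * b)" for m n
  proof -
    have "zmult m v1 + zmult n v2 = 0 \<longleftrightarrow> (m, n) \<in> associated_lattice v1 v2"
      by (simp add: associated_lattice_def)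
    also have "\<dots> \<longleftrightarrow> (\<exists>k. m = - (k * a) \<and> n = k * b)"
      using assms(5) by (auto simp: cyclic_subgroup_def zmult_int_pair)
    finally show ?thesis .
  qed
  interpret G: two_generator_ulam v1 v2 U a b
    by unfold_locales (use assms rel in auto)
  interpret G': two_generator_ulam v2 v1 U b a
    by (rule two_generator_ulam_swap) unfold_locales
  obtain u where "u \<in> U" "alpha v1 v2 U u = (x, y)"
    using assms(6) by auto
  then have g: "alpha_graph v1 v2 U u (x, y)"
    using G.alpha_graph_alpha by metis
  then have g': "alpha_graph v2 v1 U u (y, x)"
    using alpha_graph_swap by fastforce
  show ?thesis
    using G.alpha_graph_bound_and_column[OF g] G'.alpha_graph_bound_and_column[OF g']
      assms(7,8) by auto
qed

end
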